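(* Consider the vector-valued Markov decision process with $m=2$, $N=4$, $S=\{s_1,s_2\}$, $A_{s_1}=A_{s_2}=A=\{a_1,a_2\}$, and, for all $t\in\{1,2,3\}$, $$p_t(s_1\mid s_1,a_1)=\tfrac34,\quad p_t(s_1\mid s_1,a_2)=p_t(s_1\mid s_2,a_1)=p_t(s_1\mid s_2,a_2)=\tfrac12,$$ (with $p_t(s_2\mid s,a)=1-p_t(s_1\mid s,a)$), $$R_t(s_1,a_1)=(11,-5),\quad R_t(s_1,a_2)=(9,5),\quad R_t(s_2,a_1)=(5,5),\quad R_t(s_2,a_2)=(5,-10),$$ and terminal rewards $R_4(s_1)=(1,0)$, $R_4(s_2)=(0,1)$. Then $U_1(s_1)\neq e(V_1(s_1))$. In particular, the assertion that $U_t(s)=e(V_t(s))$ for all $t\le N$ and $s\in S$ fails for this process.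
   Context: Order on $\mathbb{R}^m$: $x\ge y$ iff $x_i\ge y_i$ for all $i$. For $X\subseteq\mathbb{R}^m$, the efficient subset is $e(X)=\{x\in X : \forall y\in X,\ y\ge x\Rightarrow y=x\}$. A vector-valued Markov decision process has a finite state set $S$, action sets $A_s$ ($s\in S$), $A=\bigcup_s A_s$, a horizon $N$, rewards $R_t(s,a)\in\mathbb{R}^m$ for $t=1,\dots,N-1$, $a\in A_s$, terminal rewards $R_N(s)\in\mathbb{R}^m$, and transition probabilities $p_t(j\mid s,a)$ (probability of state $j$ at epoch $t+1$ given action $a$ in state $s$ at epoch $t$). A Markovian decision rule is a map $d:S\to A$ with $d(s)\in A_s$. A Markovian policy is a sequence $\pi=(d_1,\dots,d_{N-1})$ of Markovian decision rules; $P_W$ is the set of all of them. The expected total reward of $\pi$ from epoch $t$ in state $s$ is given by $u_N^\pi(s)=R_N(s)$ and, for $t<N$, $u_t^\pi(s)=R_t(s,d_t(s))+\sum_{j\in S}p_t(j\mid s,d_t(s))\,u_{t+1}^\pi(j)$. Set $V_t(s)=\{u_t^\pi(s):\pi\in P_W\}$. The sets $U_t(s)$ are defined by backward recursion (White's equations): $U_N(s)=\{R_N(s)\}$ and, for $t<N$, $$U_t(s)=e\Bigl(\bigl\{R_t(s,a)+\textstyle\sum_{j\in S}p_t(j\mid s,a)v_j : a\in A_s,\ v_j\in U_{t+1}(j)\ \text{for all } j\in S\bigr\}\Bigr).$$ *)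

theory Defs
  imports "HOL-Analysis.Analysis"
begin

text \<open>The library order on \<^typ>\<open>real ^ 'm\<close> is the componentwise one.\<close>

definition efficient :: "(real ^ 'm) set \<Rightarrow> (real ^ 'm) set" where
  "efficient X = {x \<in> X. \<forall>y\<in>X. x \<le> y \<longrightarrow> y = x}"

text \<open>Epochs are the natural numbers from 1 to the horizon; \<open>transition M t s a j\<close> is the
  probability of being in state \<open>j\<close> at epoch \<open>t + 1\<close> when action \<open>a\<close> is taken in state \<open>s\<close>
  at epoch \<open>t\<close>.\<close>

record ('s, 'a, 'm::finite) vector_mdp =
  states :: "'s set"
  actions :: "'s \<Rightarrow> 'a set"
  horizon :: nat
  reward :: "nat \<Rightarrow> 's \<Rightarrow> 'a \<Rightarrow> real ^ 'm"
  terminal_reward :: "'s \<Rightarrow> real ^ 'm"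
  transition :: "nat \<Rightarrow> 's \<Rightarrow> 'a \<Rightarrow> 's \<Rightarrow> real"

definition is_vector_mdp :: "('s, 'a, 'm::finite) vector_mdp \<Rightarrow> bool" where
  "is_vector_mdp M \<longleftrightarrow>
     finite (states M) \<and> states M \<noteq> {} \<and> 1 \<le> horizon M \<and>
     (\<forall>s\<in>states M. actions M s \<noteq> {}) \<and>
     (\<forall>t\<in>{1..<horizon M}. \<forall>s\<in>states M. \<forall>a\<in>actions M s.
        (\<forall>j\<in>states M. 0 \<le> transition M t s a j) \<and>
        (\<Sum>j\<in>states M. transition M t s a j) = 1)"

definition decision_rules :: "('s, 'a, 'm::finite) vector_mdp \<Rightarrow> ('s \<Rightarrow> 'a) set" where
  "decision_rules M = (\<Pi>\<^sub>E s\<in>states M. actions M s)"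

definition markov_policies :: "('s, 'a, 'm::finite) vector_mdp \<Rightarrow> (nat \<Rightarrow> 's \<Rightarrow> 'a) set" where
  "markov_policies M = (\<Pi>\<^sub>E t\<in>{1..<horizon M}. decision_rules M)"

text \<open>In the two backward recursions below, epochs beyond the horizon (which play no role) are
  treated like the horizon itself.\<close>

function expected_reward ::
    "('s, 'a, 'm::finite) vector_mdp \<Rightarrow> (nat \<Rightarrow> 's \<Rightarrow> 'a) \<Rightarrow> nat \<Rightarrow> 's \<Rightarrow> real ^ 'm" where
  "expected_reward M \<pi> t s =
     (if t < horizon M
      then reward M t s (\<pi> t s) +
           (\<Sum>j\<in>states M. transition M t s (\<pi> t s) j *\<^sub>R expected_reward M \<pi> (t + 1) j)
      else terminal_reward M s)"
  by pat_completeness auto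
termination
  by (relation "Wellfounded.measure (\<lambda>(M, \<pi>, t, s). horizon M - t)") auto

definition policy_values :: "('s, 'a, 'm::finite) vector_mdp \<Rightarrow> nat \<Rightarrow> 's \<Rightarrow> (real ^ 'm) set" where
  "policy_values M t s = {expected_reward M \<pi> t s | \<pi>. \<pi> \<in> markov_policies M}"

function white_set :: "('s, 'a, 'm::finite) vector_mdp \<Rightarrow> nat \<Rightarrow> 's \<Rightarrow> (real ^ 'm) set" where
  "white_set M t s =
     (if t < horizon M
      then efficient {reward M t s a + (\<Sum>j\<in>states M. transition M t s a j *\<^sub>R v j) | a v.
             a \<in> actions M s \<and> (\<forall>j\<in>states M. v j \<in> white_set M (t + 1) j)}
      else {terminal_reward M s})"
  by pat_completeness auto
termination
  by (relation "Wellfounded.measure (\<lambda>(M, t, s). horizon M - t)") auto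

text \<open>The recursion equations would loop as rewrite rules.\<close>

declare expected_reward.simps [simp del] white_set.simps [simp del]

datatype state = s\<^sub>1 | s\<^sub>2

datatype action = a\<^sub>1 | a\<^sub>2

fun example_reward :: "state \<Rightarrow> action \<Rightarrow> real ^ 2" where
  "example_reward s\<^sub>1 a\<^sub>1 = vector [11, -5]"
| "example_reward s\<^sub>1 a\<^sub>2 = vector [9, 5]"
| "example_reward s\<^sub>2 a\<^sub>1 = vector [5, 5]"
| "example_reward s\<^sub>2 a\<^sub>2 = vector [5, -10]"

fun example_terminal_reward :: "state \<Rightarrow> real ^ 2" where
  "example_terminal_reward s\<^sub>1 = vector [1, 0]"
| "example_terminal_reward s\<^sub>2 = vector [0, 1]"

fun example_prob_s\<^sub>1 :: "state \<Rightarrow> action \<Rightarrow> real" where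
  "example_prob_s\<^sub>1 s\<^sub>1 a\<^sub>1 = 3 / 4"
| "example_prob_s\<^sub>1 s\<^sub>1 a\<^sub>2 = 1 / 2"
| "example_prob_s\<^sub>1 s\<^sub>2 a\<^sub>1 = 1 / 2"
| "example_prob_s\<^sub>1 s\<^sub>2 a\<^sub>2 = 1 / 2"

fun example_transition :: "state \<Rightarrow> action \<Rightarrow> state \<Rightarrow> real" where
  "example_transition s a s\<^sub>1 = example_prob_s\<^sub>1 s a"
| "example_transition s a s\<^sub>2 = 1 - example_prob_s\<^sub>1 s a"

definition example_mdp :: "(state, action, 2) vector_mdp" where
  "example_mdp =
     \<lparr>states = {s\<^sub>1, s\<^sub>2},
      actions = (\<lambda>s. {a\<^sub>1, a\<^sub>2}),
      horizon = 4,
      reward = (\<lambda>t. example_reward),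
      terminal_reward = example_terminal_reward,
      transition = (\<lambda>t. example_transition)\<rparr>"

lemma is_vector_mdp_example: "is_vector_mdp example_mdp"
  by (auto simp: is_vector_mdp_def example_mdp_def)

end

theory Submission
  imports Defs
begin

text \<open>The set \<open>U\<^sub>2(s\<^sub>1)\<close> contains (33/2, 21/2), reached by playing \<open>a\<^sub>2\<close> at epochs 2 and 3, and
  \<open>U\<^sub>2(s\<^sub>2)\<close> contains (109/8, 43/8), reached by playing \<open>a\<^sub>1\<close> in \<open>s\<^sub>2\<close> at epoch 2 and then \<open>a\<^sub>1\<close>
  in \<open>s\<^sub>1\<close> at epoch 3. White's recursion may combine these two although they prescribe different
  actions for the same state \<open>s\<^sub>1\<close> at epoch 3, which no Markovian policy can do. After \<open>a\<^sub>2\<close> in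
  \<open>s\<^sub>1\<close> at epoch 1 the combination is worth (385/16, 207/16); this vector is undominated, hence
  in \<open>U\<^sub>1(s\<^sub>1)\<close>, but it is not the value of any Markovian policy.\<close>

lemma vector_2_le_iff: "(vector [a, b] :: real ^ 2) \<le> vector [c, d] \<longleftrightarrow> a \<le> c \<and> b \<le> d"
  by (simp add: less_eq_vec_def forall_2)

lemma vector_2_eq_iff: "(vector [a, b] :: 'a::zero ^ 2) = vector [c, d] \<longleftrightarrow> a = c \<and> b = d"
  by (simp add: vec_eq_iff forall_2)

lemma vector_2_add: "(vector [a, b] :: real ^ 2) + vector [c, d] = vector [a + c, b + d]"
  by (simp add: vec_eq_iff forall_2)

lemma vector_2_scaleR: "r *\<^sub>R (vector [a, b] :: real ^ 2) = vector [r * a, r * b]"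
  by (simp add: vec_eq_iff forall_2)

lemmas vector_2_simps = vector_2_le_iff vector_2_eq_iff vector_2_add vector_2_scaleR

text \<open>An efficient point lies below some point of \<open>Y\<close>, hence equals it.
  Conversely, anything above \<open>y\<close> in \<open>Y\<close> lies below some \<open>z\<close>
  in \<open>Y\<close>, and the antichain condition gives \<open>y = z\<close>. This reduces
  computing an efficient set to checking a list of candidates.\<close>

lemma efficient_eqI:
  assumes "Y \<subseteq> X"
    and dominated: "\<And>x. x \<in> X \<Longrightarrow> \<exists>y\<in>Y. x \<le> y"
    and antichain: "\<And>y z. y \<in> Y \<Longrightarrow> z \<in> Y \<Longrightarrow> y \<le> z \<Longrightarrow> y = z"
  shows "efficient X = Y"
proof
  show "efficient X \<subseteq> Y"
    using assms(1) dominated unfolding efficient_def by blast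
  show "Y \<subseteq> efficient X"
  proof
    fix y assume "y \<in> Y"
    have "x = y" if "x \<in> X" "y \<le> x" for x
    proof -
      obtain z where "z \<in> Y" "x \<le> z" using dominated \<open>x \<in> X\<close> by blast
      then have "y = z" using antichain \<open>y \<in> Y\<close> \<open>y \<le> x\<close> order_trans by blast
      then show ?thesis using \<open>x \<le> z\<close> \<open>y \<le> x\<close> by simp
    qed
    then show "y \<in> efficient X"
      using \<open>y \<in> Y\<close> assms(1) unfolding efficient_def by blast
  qed
qed

lemma efficient_subset: "efficient X \<subseteq> X"
  by (auto simp: efficient_def)

definition example_value :: "state \<Rightarrow> action \<Rightarrow> real ^ 2 \<Rightarrow> real ^ 2 \<Rightarrow> real ^ 2" where
  "example_value s a x y =
     example_reward s a + (example_prob_s\<^sub>1 s a *\<^sub>R x + (1 - example_prob_s\<^sub>1 s a) *\<^sub>R y)"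

lemma white_set_example_terminal:
  "white_set example_mdp 4 s = {example_terminal_reward s}"
  by (subst white_set.simps) (simp add: example_mdp_def)

text \<open>With two states, the choice function \<open>v\<close> amounts to a pair
  \<open>x\<close>, \<open>y\<close>. The nested unions let the simplifier enumerate all
  combinations.\<close>

lemma white_set_example_step:
  assumes "t < 4"
  shows "white_set example_mdp t s =
    efficient (\<Union>a\<in>{a\<^sub>1, a\<^sub>2}. \<Union>x\<in>white_set example_mdp (t + 1) s\<^sub>1.
      \<Union>y\<in>white_set example_mdp (t + 1) s\<^sub>2. {example_value s a x y})"
    (is "_ = efficient ?X")
proof -
  let ?W = "white_set example_mdp (t + 1)"
  have "{example_reward s a + (\<Sum>j\<in>{s\<^sub>1, s\<^sub>2}. example_transition s a j *\<^sub>R v j) | a v.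
      a \<in> {a\<^sub>1, a\<^sub>2} \<and> (\<forall>j\<in>{s\<^sub>1, s\<^sub>2}. v j \<in> ?W j)} = ?X" (is "?L = _")
  proof
    show "?L \<subseteq> ?X" by (fastforce simp: example_value_def)
    show "?X \<subseteq> ?L"
    proof
      fix z assume "z \<in> ?X"
      then obtain a x y where *: "a \<in> {a\<^sub>1, a\<^sub>2}" "x \<in> ?W s\<^sub>1" "y \<in> ?W s\<^sub>2" "z = example_value s a x y"
        by blast
      let ?v = "\<lambda>j. case j of s\<^sub>1 \<Rightarrow> x | s\<^sub>2 \<Rightarrow> y"
      have "z = example_reward s a + (\<Sum>j\<in>{s\<^sub>1, s\<^sub>2}. example_transition s a j *\<^sub>R ?v j)"
        using *(4) by (simp add: example_value_def)
      moreover have "\<forall>j\<in>{s\<^sub>1, s\<^sub>2}. ?v j \<in> ?W j" using * by simp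
      ultimately show "z \<in> ?L" using *(1) by blast
    qed
  qed
  then show ?thesis
    using assms by (subst white_set.simps) (simp add: example_mdp_def)
qed

text \<open>In \<open>s\<^sub>2\<close>, \<open>a\<^sub>2\<close> has the same transitions as
  \<open>a\<^sub>1\<close> and a smaller second reward, so it is always dominated.\<close>

lemma white_set_example_3:
  "white_set example_mdp 3 s\<^sub>1 = {vector [19/2, 11/2], vector [47/4, -19/4]}"
  "white_set example_mdp 3 s\<^sub>2 = {vector [11/2, 11/2]}"
  by (subst white_set_example_step, simp, rule efficient_eqI;
      force simp: white_set_example_terminal example_value_def vector_2_simps)+

text \<open>In \<open>s\<^sub>1\<close> all four combinations of an action now with a point of
  U_3(s1) survive; in \<open>s\<^sub>2\<close> only the two that start with \<open>a\<^sub>1\<close>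
  do.\<close>

lemma white_set_example_2:
  "white_set example_mdp 2 s\<^sub>1 =
    {vector [33/2, 21/2], vector [141/8, 43/8], vector [39/2, 1/2], vector [339/16, -115/16]}"
  "white_set example_mdp 2 s\<^sub>2 = {vector [25/2, 21/2], vector [109/8, 43/8]}"
  by (subst white_set_example_step, simp, rule efficient_eqI;
      force simp: white_set_example_3 example_value_def vector_2_simps)+

lemma in_white_set_example_1: "vector [385/16, 207/16] \<in> white_set example_mdp 1 s\<^sub>1"
proof -
  define X where "X = (\<Union>a\<in>{a\<^sub>1, a\<^sub>2}. \<Union>x\<in>white_set example_mdp 2 s\<^sub>1.
    \<Union>y\<in>white_set example_mdp 2 s\<^sub>2. {example_value s\<^sub>1 a x y})"
  have "white_set example_mdp 1 s\<^sub>1 = efficient X"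
    using white_set_example_step[of 1 s\<^sub>1] unfolding X_def one_add_one by simp
  moreover have "vector [385/16, 207/16] = example_value s\<^sub>1 a\<^sub>2 (vector [33/2, 21/2]) (vector [109/8, 43/8])"
    by (simp add: example_value_def vector_2_simps)
  then have "vector [385/16, 207/16] \<in> X"
    unfolding X_def white_set_example_2 by blast
  \<comment> \<open>Unfolding leaves one comparison for each of the 2 * 4 * 2 choices of action and
    continuation values.\<close>
  moreover have "\<forall>z\<in>X. vector [385/16, 207/16] \<le> z \<longrightarrow> z = vector [385/16, 207/16]"
    unfolding X_def white_set_example_2 UN_insert UN_empty ball_Un Un_empty_right
    by (simp add: example_value_def vector_2_simps)
  ultimately show ?thesis
    by (simp add: efficient_def)
qed

lemma expected_reward_example_terminal:
  "expected_reward example_mdp \<pi> 4 s = example_terminal_reward s"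
  by (subst expected_reward.simps) (simp add: example_mdp_def)

lemma expected_reward_example_step:
  assumes "t < 4"
  shows "expected_reward example_mdp \<pi> t s =
    example_value s (\<pi> t s) (expected_reward example_mdp \<pi> (t + 1) s\<^sub>1)
      (expected_reward example_mdp \<pi> (t + 1) s\<^sub>2)"
  using assms by (subst expected_reward.simps) (simp add: example_mdp_def example_value_def)

lemma notin_policy_values_example_1:
  "vector [385/16, 207/16] \<notin> policy_values example_mdp 1 s\<^sub>1"
proof -
  have "expected_reward example_mdp \<pi> 1 s\<^sub>1 \<noteq> vector [385/16, 207/16]" for \<pi>
  proof -
    have 3: "expected_reward example_mdp \<pi> 3 s =
        example_value s (\<pi> 3 s) (vector [1, 0]) (vector [0, 1])" for s
      by (simp add: expected_reward_example_step expected_reward_example_terminal)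
    have 2: "expected_reward example_mdp \<pi> 2 s =
        example_value s (\<pi> 2 s) (expected_reward example_mdp \<pi> 3 s\<^sub>1)
          (expected_reward example_mdp \<pi> 3 s\<^sub>2)" for s
      by (simp add: expected_reward_example_step)
    have 1: "expected_reward example_mdp \<pi> 1 s\<^sub>1 =
        example_value s\<^sub>1 (\<pi> 1 s\<^sub>1) (expected_reward example_mdp \<pi> 2 s\<^sub>1)
          (expected_reward example_mdp \<pi> 2 s\<^sub>2)"
      by (simp add: expected_reward_example_step del: One_nat_def)
    \<comment> \<open>The value depends on five actions only, which gives 32 cases. Both epoch 2
      values use the same \<open>\<pi> 3 s\<^sub>1\<close>; here the Markov restriction
      enters.\<close>
    show ?thesis
      unfolding 1 2 3
      by (cases "\<pi> 1 s\<^sub>1"; cases "\<pi> 2 s\<^sub>1"; cases "\<pi> 2 s\<^sub>2"; cases "\<pi> 3 s\<^sub>1"; cases "\<pi> 3 s\<^sub>2")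
         (simp_all add: example_value_def vector_2_simps)
  qed
  then show ?thesis
    unfolding policy_values_def by (auto dest: sym)
qed

theorem mainTheorem1:
  shows "white_set example_mdp 1 s\<^sub>1 \<noteq> efficient (policy_values example_mdp 1 s\<^sub>1) \<and>
    \<not> (\<forall>t\<in>{1..horizon example_mdp}. \<forall>s\<in>states example_mdp.
         white_set example_mdp t s = efficient (policy_values example_mdp t s))"
proof -
  have "white_set example_mdp 1 s\<^sub>1 \<noteq> efficient (policy_values example_mdp 1 s\<^sub>1)"
    using in_white_set_example_1 notin_policy_values_example_1 efficient_subset by blast
  moreover have "1 \<in> {1..horizon example_mdp}" "s\<^sub>1 \<in> states example_mdp"
    by (simp_all add: example_mdp_def)
  ultimately show ?thesis by blast
qed

end
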